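(* Let $X$ be a positive random variable with Laplace transform $\psi(t):=\mathbb{E}\,e^{-tX}$, $t\ge 0$. The following are equivalent: (i) $X$ has negative moments of all orders, i.e., $\mathbb{E}\,X^{-s}<\infty$ for all $s>0$; (ii) $\int_0^\infty t^{s-1}\psi(t)\,dt<\infty$ for all $s>0$; (iii) $\psi(t)=O(t^{-N})$ as $t\to\infty$ for all $N$. If these hold and further $X$ has moments of all (positive) orders, then $s\mapsto\mathbb{E}\,X^{-s}$ is an entire function of $s$; further, the identity $$\int_0^\infty t^{s-1}\psi(t)\,dt=\Gamma(s)\,\mathbb{E}\,X^{-s}$$ holds for $\operatorname{Re}s>0$, and its right-hand side defines a meromorphic extension of $\int_0^\infty t^{s-1}\psi(t)\,dt$ to the complex plane. *)

theory Defs
  imports "HOL-Probability.Probability" "HOL-Complex_Analysis.Complex_Analysis"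
begin

definition laplace_transform :: "'a measure \<Rightarrow> ('a \<Rightarrow> real) \<Rightarrow> real \<Rightarrow> real" where
  "laplace_transform M X t = (\<integral>\<omega>. exp (- t * X \<omega>) \<partial>M)"

text \<open>
  The function \<open>s \<mapsto> E X\<^sup>-\<^sup>s\<close> for complex \<open>s\<close>. For \<open>x > 0\<close> the principal power
  \<open>of_real x powr (- s)\<close> is \<open>exp (- s * ln x)\<close>.  Like every Bochner integral it is \<open>0\<close>
  by convention where the integrand is not integrable, so integrability has to be
  claimed separately.
\<close>
definition neg_moment :: "'a measure \<Rightarrow> ('a \<Rightarrow> real) \<Rightarrow> complex \<Rightarrow> complex" where
  "neg_moment M X s = (\<integral>\<omega>. complex_of_real (X \<omega>) powr (- s) \<partial>M)"

text \<open>
  For a nonnegative random variable, integrability of a power means that the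
  corresponding moment is finite.
\<close>
definition negative_moments_finite :: "'a measure \<Rightarrow> ('a \<Rightarrow> real) \<Rightarrow> bool" where
  "negative_moments_finite M X \<longleftrightarrow>
     (\<forall>s::real. s > 0 \<longrightarrow> integrable M (\<lambda>\<omega>. X \<omega> powr (- s)))"

definition positive_moments_finite :: "'a measure \<Rightarrow> ('a \<Rightarrow> real) \<Rightarrow> bool" where
  "positive_moments_finite M X \<longleftrightarrow>
     (\<forall>s::real. s > 0 \<longrightarrow> integrable M (\<lambda>\<omega>. X \<omega> powr s))"

end

theory Submission
  imports Defs
begin

text \<open>
  Everything rests on the Gamma integral
  \<open>\<integral>\<^sub>0\<^sup>\<infinity> t\<^sup>s\<^sup>-\<^sup>1 e\<^sup>-\<^sup>t\<^sup>x dt = \<Gamma>(s) x\<^sup>-\<^sup>s\<close> for \<open>x > 0\<close>, \<open>Re s > 0\<close>, applied with \<open>x = X(\<omega>)\<close>.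
  Consider the kernel \<open>t\<^sup>s\<^sup>-\<^sup>1 e\<^sup>-\<^sup>t\<^sup>X\<close> on the product of the probability space with the positive
  half-line. Integrating its absolute value first in \<open>t\<close> gives a multiple of \<open>X\<close> to the power
  \<open>- Re s\<close>, and integrating it first in \<open>\<omega>\<close> gives \<open>t\<close> to the power \<open>Re s - 1\<close> times \<open>\<psi>(t)\<close>. By
  Tonelli's theorem the negative moment of order \<open>Re s\<close> and the Mellin integral of \<open>\<psi>\<close> at \<open>Re s\<close>
  are therefore finite together (\<open>integrable_mellin_kernel_iff_neg_moment\<close> and
  \<open>integrable_mellin_kernel_iff_laplace\<close>), which is the equivalence of the first two conditions, one
  order at a time. Once the kernel is integrable, Fubini's theorem exchanges the two integrals and
  yields the identity (\<open>mellin_transform_laplace_transform\<close>).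

  The decay condition is tied to the other two by pointwise bounds. A negative moment of
  order \<open>N\<close> forces \<open>\<psi>(t) = O(t\<^sup>-\<^sup>N)\<close>, since \<open>e\<^sup>-\<^sup>y \<le> N! y\<^sup>-\<^sup>N\<close>. Conversely, \<open>\<psi> \<le> 1\<close> makes the Mellin
  integral converge near \<open>0\<close>, and decay of order \<open>N > s\<close> makes it converge near infinity.

  When \<open>X\<close> has moments of all orders, \<open>L = - ln X\<close> satisfies \<open>E e\<^sup>r\<^sup>|\<^sup>L\<^sup>| < \<infinity>\<close> for all \<open>r\<close>, because
  \<open>e\<^sup>r\<^sup>|\<^sup>L\<^sup>| \<le> X\<^sup>r + X\<^sup>-\<^sup>r\<close>. Hence \<open>E X\<^sup>-\<^sup>s = E e\<^sup>s\<^sup>L\<close> can be expanded as an everywhere convergent power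
  series in \<open>s\<close> (\<open>holomorphic_integral_exp\<close>). Its product with \<open>\<Gamma>\<close> is meromorphic. At the pole
  \<open>-n\<close> of \<open>\<Gamma>\<close> the entire factor equals \<open>E X\<^sup>n > 0\<close>, so no pole is cancelled, and the value \<open>0\<close>
  that the product takes there through the convention \<open>\<Gamma>(-n) = 0\<close> is the normalised one.
\<close>

section \<open>Integrals of the Gamma kernel\<close>

text \<open>
  The case \<open>x = 1\<close> is Euler's integral; the general case follows by the substitution \<open>t \<mapsto> x t\<close>,
  under which the power of \<open>t\<close> contributes \<open>x\<^sup>s\<^sup>-\<^sup>1\<close> and \<open>dt\<close> contributes \<open>x\<close>.
\<close>
lemma set_integrable_Gamma_kernel:
  fixes s :: complex and x :: real
  assumes s: "Re s > 0" and x: "x > 0"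
  shows "set_integrable lborel {0<..} (\<lambda>t. of_real t powr (s - 1) * of_real (exp (- t * x)))" (is ?A)
    and "(LINT t:{0<..}|lborel. of_real t powr (s - 1) * of_real (exp (- t * x)))
           = Gamma s * of_real x powr (- s)" (is ?B)
proof -
  define g :: "real \<Rightarrow> complex"
    where "g t = indicator {0<..} t *\<^sub>R (of_real t powr (s - 1) / of_real (exp t))" for t
  have [measurable]: "g \<in> borel_measurable borel"
    unfolding g_def powr_def by measurable
  \<comment> \<open>Euler's integral is available over the completed measure; a Borel function has the same
    integral over both.\<close>
  have "integrable (completion lborel) g"
    using absolutely_integrable_Gamma_integral'[OF s] unfolding set_integrable_def g_def .
  then have g: "integrable lborel g"
    by (subst (asm) integrable_completion) simp_all
  have "(g has_integral Gamma s) UNIV"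
  proof -
    have "g = (\<lambda>t. if t \<in> {0<..} then of_real t powr (s - 1) / of_real (exp t) else 0)"
      by (auto simp: g_def)
    then show ?thesis
      using Gamma_integral_complex'[OF s] by (simp only: has_integral_restrict_UNIV)
  qed
  with has_integral_integral_lborel[OF g] have g_int: "(\<integral>t. g t \<partial>lborel) = Gamma s"
    by (rule has_integral_unique)
  have scale: "indicator {0<..} t *\<^sub>R (of_real t powr (s - 1) * of_real (exp (- t * x)))
                 = of_real x powr (1 - s) * g (0 + x * t)" for t
  proof (cases "t > 0")
    case True
    then have "of_real (x * t) powr (s - 1) = (of_real x powr (s - 1) * of_real t powr (s - 1) :: complex)"
      using x by (simp add: powr_times_real)
    moreover have "of_real x powr (1 - s) * of_real x powr (s - 1) = (1 :: complex)"
      using x by (simp flip: powr_add)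
    ultimately show ?thesis
      using True x by (simp add: g_def exp_minus divide_inverse mult_ac)
  qed (use x in \<open>auto simp: g_def zero_less_mult_iff\<close>)
  show ?A
    unfolding set_integrable_def scale
    using g x by (intro integrable_mult_right lborel_integrable_real_affine) auto
  have "of_real x * (\<integral>t. g (0 + x * t) \<partial>lborel) = Gamma s"
    using lborel_integral_real_affine[of x g 0] x g_int by (simp add: scaleR_conv_of_real)
  then have "(\<integral>t. g (0 + x * t) \<partial>lborel) = Gamma s / of_real x"
    using x by (simp add: field_simps)
  moreover have "of_real x powr (1 - s) = of_real x * (of_real x powr (- s) :: complex)"
    using x by (simp add: powr_diff powr_minus divide_inverse)
  ultimately show ?B
    unfolding set_lebesgue_integral_def scale
    using x by simp
qed

lemma LINT_Gamma_kernel_real: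
  fixes s x :: real
  assumes "s > 0" "x > 0"
  shows "(LINT t:{0<..}|lborel. t powr (s - 1) * exp (- t * x)) = Gamma s * x powr (- s)"
proof -
  have "complex_of_real (LINT t:{0<..}|lborel. t powr (s - 1) * exp (- t * x))
      = (LINT t:{0<..}|lborel. of_real t powr (of_real s - 1) * of_real (exp (- t * x)))"
    unfolding set_integral_complex_of_real [symmetric]
    by (intro set_lebesgue_integral_cong) (auto simp flip: powr_of_real)
  also have "\<dots> = Gamma (of_real s) * of_real x powr (- of_real s)"
    by (rule set_integrable_Gamma_kernel) (use assms in auto)
  also have "\<dots> = of_real (Gamma s * x powr (- s))"
    using assms by (simp add: Gamma_complex_of_real flip: powr_of_real)
  finally show ?thesis
    unfolding of_real_eq_iff .
qed

section \<open>Exchanging the Mellin integral and the expectation\<close>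

text \<open>
  The indicator is part of the kernel so that Fubini's theorem applies on the whole real line.
\<close>
definition mellin_kernel :: "('a \<Rightarrow> real) \<Rightarrow> complex \<Rightarrow> 'a \<Rightarrow> real \<Rightarrow> complex" where
  "mellin_kernel X s \<omega> t =
     indicator {0<..} t *\<^sub>R (of_real t powr (s - 1) * of_real (exp (- t * X \<omega>)))"

lemma borel_measurable_mellin_kernel:
  assumes [measurable]: "X \<in> borel_measurable M"
  shows "case_prod (mellin_kernel X s) \<in> borel_measurable (M \<Otimes>\<^sub>M lborel)"
  unfolding mellin_kernel_def powr_def by measurable

lemma norm_mellin_kernel:
  "norm (mellin_kernel X s \<omega> t) = indicator {0<..} t *\<^sub>R (t powr (Re s - 1) * exp (- t * X \<omega>))"
  by (auto simp: mellin_kernel_def norm_mult norm_powr_real_powr split: split_indicator)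

context finite_measure
begin

lemma integrable_exp_neg_mult:
  assumes [measurable]: "X \<in> borel_measurable M" and "AE \<omega> in M. X \<omega> > 0" "t \<ge> (0::real)"
  shows "integrable M (\<lambda>\<omega>. exp (- t * X \<omega>))"
  by (rule integrable_const_bound[where B = 1]) (use assms in \<open>auto elim!: eventually_mono\<close>)

lemma integral_mellin_kernel_fst:
  "(\<integral>\<omega>. mellin_kernel X s \<omega> t \<partial>M)
     = indicator {0<..} t *\<^sub>R (of_real t powr (s - 1) * of_real (laplace_transform M X t))"
  unfolding mellin_kernel_def laplace_transform_def by (simp flip: integral_complex_of_real)

lemma integral_norm_mellin_kernel_fst:
  "(\<integral>\<omega>. norm (mellin_kernel X s \<omega> t) \<partial>M)
     = indicator {0<..} t *\<^sub>R (t powr (Re s - 1) * laplace_transform M X t)"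
  unfolding norm_mellin_kernel laplace_transform_def by simp

text \<open>
  For fixed \<open>\<omega>\<close> the absolute value of the kernel has the \<open>t\<close>-integral \<open>\<Gamma>(\<sigma>) X(\<omega>)\<^sup>-\<^sup>\<sigma>\<close> with
  \<open>\<sigma> = Re s\<close>, and \<open>\<Gamma>(\<sigma>) > 0\<close>. Tonelli's theorem turns this into an equivalence.
\<close>
lemma integrable_mellin_kernel_iff_neg_moment:
  assumes X [measurable]: "X \<in> borel_measurable M" and pos: "AE \<omega> in M. X \<omega> > 0" and s: "Re s > 0"
  shows "integrable (M \<Otimes>\<^sub>M lborel) (case_prod (mellin_kernel X s))
           \<longleftrightarrow> integrable M (\<lambda>\<omega>. X \<omega> powr (- Re s))" (is "?K \<longleftrightarrow> ?I")
proof -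
  interpret P: pair_sigma_finite M "lborel :: real measure" ..
  note [measurable] = borel_measurable_mellin_kernel[OF X, of s]
  have "AE \<omega> in M. (\<integral>t. norm (mellin_kernel X s \<omega> t) \<partial>lborel) = Gamma (Re s) * X \<omega> powr (- Re s)"
    using pos
  proof eventually_elim
    case (elim \<omega>)
    then show ?case
      using LINT_Gamma_kernel_real[OF s elim]
      by (simp add: norm_mellin_kernel set_lebesgue_integral_def)
  qed
  then have "integrable M (\<lambda>\<omega>. \<integral>t. norm (mellin_kernel X s \<omega> t) \<partial>lborel)
               \<longleftrightarrow> integrable M (\<lambda>\<omega>. Gamma (Re s) * X \<omega> powr (- Re s))"
    by (intro integrable_cong_AE) measurable
  also have "\<dots> \<longleftrightarrow> ?I"
    using Gamma_real_pos[OF s] by simp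
  finally have *: "integrable M (\<lambda>\<omega>. \<integral>t. norm (mellin_kernel X s \<omega> t) \<partial>lborel) \<longleftrightarrow> ?I" .
  show ?thesis
  proof
    assume ?K
    then have "integrable (M \<Otimes>\<^sub>M lborel) (\<lambda>(\<omega>, t). norm (mellin_kernel X s \<omega> t))"
      using integrable_norm by (fastforce simp: case_prod_unfold)
    from P.integrable_fst[OF this] show ?I
      unfolding * .
  next
    assume ?I
    show ?K
    proof (rule P.Fubini_integrable)
      show "AE \<omega> in M. integrable lborel (\<lambda>t. case_prod (mellin_kernel X s) (\<omega>, t))"
        using pos
        by eventually_elim
           (use set_integrable_Gamma_kernel(1)[OF s] in \<open>simp add: mellin_kernel_def set_integrable_def\<close>)
    qed (use \<open>?I\<close> * in simp_all)
  qed
qed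

text \<open>
  The same iterated integral in the other order: for fixed \<open>t > 0\<close> the power of \<open>t\<close> is a constant
  and the expectation of the exponential is the Laplace transform.
\<close>
lemma integrable_mellin_kernel_iff_laplace:
  assumes X [measurable]: "X \<in> borel_measurable M" and pos: "AE \<omega> in M. X \<omega> > 0"
  shows "integrable (M \<Otimes>\<^sub>M lborel) (case_prod (mellin_kernel X s))
           \<longleftrightarrow> set_integrable lborel {0<..} (\<lambda>t. t powr (Re s - 1) * laplace_transform M X t)"
    (is "?K \<longleftrightarrow> ?I")
proof -
  interpret P: pair_sigma_finite M "lborel :: real measure" ..
  interpret Q: pair_sigma_finite "lborel :: real measure" M ..
  note [measurable] = borel_measurable_mellin_kernel[OF X, of s]
  have *: "integrable lborel (\<lambda>t. \<integral>\<omega>. norm (mellin_kernel X s \<omega> t) \<partial>M) \<longleftrightarrow> ?I"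
    by (simp add: integral_norm_mellin_kernel_fst set_integrable_def)
  show ?thesis
  proof
    assume ?K
    then have "integrable (M \<Otimes>\<^sub>M lborel) (\<lambda>(\<omega>, t). norm (mellin_kernel X s \<omega> t))"
      using integrable_norm by (fastforce simp: case_prod_unfold)
    from P.integrable_snd[OF this] show ?I
      unfolding * .
  next
    assume ?I
    have "integrable (lborel \<Otimes>\<^sub>M M) (\<lambda>(t, \<omega>). mellin_kernel X s \<omega> t)"
    proof (rule Q.Fubini_integrable)
      show "AE t in lborel. integrable M (\<lambda>\<omega>. case (t, \<omega>) of (t, \<omega>) \<Rightarrow> mellin_kernel X s \<omega> t)"
      proof (rule AE_I2)
        fix t :: real
        show "integrable M (\<lambda>\<omega>. case (t, \<omega>) of (t, \<omega>) \<Rightarrow> mellin_kernel X s \<omega> t)"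
          using integrable_exp_neg_mult[OF X pos, of t]
          by (cases "t > 0") (auto simp: mellin_kernel_def intro!: integrable_mult_right integrable_of_real)
      qed
    qed (use \<open>?I\<close> * in simp_all)
    then show ?K
      using P.integrable_product_swap_iff[of "case_prod (mellin_kernel X s)"] by simp
  qed
qed

theorem mellin_transform_laplace_transform:
  assumes X: "X \<in> borel_measurable M" and pos: "AE \<omega> in M. X \<omega> > 0" and s: "Re s > 0"
    and int: "integrable M (\<lambda>\<omega>. X \<omega> powr (- Re s))"
  shows "set_integrable lborel {0<..} (\<lambda>t. of_real t powr (s - 1) * of_real (laplace_transform M X t))"
    and "(LINT t:{0<..}|lborel. of_real t powr (s - 1) * of_real (laplace_transform M X t))
           = Gamma s * neg_moment M X s"
proof -
  interpret P: pair_sigma_finite M "lborel :: real measure" ..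
  note [measurable] = X
  have K: "integrable (M \<Otimes>\<^sub>M lborel) (case_prod (mellin_kernel X s))"
    using integrable_mellin_kernel_iff_neg_moment[OF X pos s] int by blast
  show "set_integrable lborel {0<..} (\<lambda>t. of_real t powr (s - 1) * of_real (laplace_transform M X t))"
    using P.integrable_snd[OF K] by (simp add: set_integrable_def integral_mellin_kernel_fst)
  have "(LINT t:{0<..}|lborel. of_real t powr (s - 1) * of_real (laplace_transform M X t))
          = (\<integral>t. (\<integral>\<omega>. mellin_kernel X s \<omega> t \<partial>M) \<partial>lborel)"
    by (simp add: set_lebesgue_integral_def integral_mellin_kernel_fst)
  also have "\<dots> = (\<integral>\<omega>. (\<integral>t. mellin_kernel X s \<omega> t \<partial>lborel) \<partial>M)"
    by (rule P.Fubini_integral[OF K])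
  also have "\<dots> = (\<integral>\<omega>. Gamma s * of_real (X \<omega>) powr (- s) \<partial>M)"
  proof (rule integral_cong_AE)
    show "AE \<omega> in M. (\<integral>t. mellin_kernel X s \<omega> t \<partial>lborel) = Gamma s * of_real (X \<omega>) powr (- s)"
      using pos
    proof eventually_elim
      case (elim \<omega>)
      then show ?case
        using set_integrable_Gamma_kernel(2)[OF s elim]
        by (simp add: mellin_kernel_def set_lebesgue_integral_def)
    qed
    show "(\<lambda>\<omega>. \<integral>t. mellin_kernel X s \<omega> t \<partial>lborel) \<in> borel_measurable M"
      using borel_measurable_mellin_kernel[OF X, of s] by measurable
    show "(\<lambda>\<omega>. Gamma s * of_real (X \<omega>) powr (- s)) \<in> borel_measurable M"
      unfolding powr_def by measurable
  qed
  finally show "(LINT t:{0<..}|lborel. of_real t powr (s - 1) * of_real (laplace_transform M X t))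
           = Gamma s * neg_moment M X s"
    by (simp add: neg_moment_def)
qed

end

section \<open>Decay of the Laplace transform\<close>

text \<open>
  The exponential series dominates each of its terms, so \<open>y\<^sup>N / N! \<le> e\<^sup>y\<close>.
\<close>
lemma exp_minus_le_fact_powr:
  fixes y :: real
  assumes "y > 0"
  shows "exp (- y) \<le> fact N * y powr (- real N)"
proof -
  have "y ^ N / fact N \<le> exp y"
    using assms sum_le_suminf[OF summable_exp_generic, of "{N}" y] by (simp add: exp_def divide_inverse mult.commute)
  then show ?thesis
    using assms by (simp add: exp_minus powr_minus powr_realpow field_simps)
qed

text \<open>
  Take expectations in \<open>e\<^sup>-\<^sup>t\<^sup>X \<le> N! t\<^sup>-\<^sup>N X\<^sup>-\<^sup>N\<close>.
\<close>
lemma laplace_transform_bigo_powr: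
  assumes X [measurable]: "X \<in> borel_measurable M" and pos: "AE \<omega> in M. X \<omega> > 0"
    and int: "integrable M (\<lambda>\<omega>. X \<omega> powr (- real N))"
  shows "laplace_transform M X \<in> O[at_top](\<lambda>t. t powr (- real N))"
proof (rule bigoI)
  show "eventually (\<lambda>t. norm (laplace_transform M X t)
          \<le> (fact N * (\<integral>\<omega>. X \<omega> powr (- real N) \<partial>M)) * norm (t powr (- real N))) at_top"
    using eventually_gt_at_top[of 0]
  proof eventually_elim
    case (elim t)
    have "laplace_transform M X t \<le> (\<integral>\<omega>. fact N * t powr (- real N) * X \<omega> powr (- real N) \<partial>M)"
      unfolding laplace_transform_def
    proof (rule integral_mono_AE')
      show "AE \<omega> in M. exp (- t * X \<omega>) \<le> fact N * t powr (- real N) * X \<omega> powr (- real N)"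
        using pos
      proof eventually_elim
        case (elim \<omega>)
        then show ?case
          using exp_minus_le_fact_powr[of "t * X \<omega>" N] \<open>t > 0\<close> by (simp add: powr_mult mult_ac)
      qed
    qed (use int in auto)
    moreover have "laplace_transform M X t \<ge> 0"
      by (simp add: laplace_transform_def)
    ultimately show ?case
      by (simp add: mult_ac)
  qed
qed

lemma (in prob_space) laplace_transform_le_1:
  assumes "X \<in> borel_measurable M" "AE \<omega> in M. X \<omega> > 0" "t \<ge> (0::real)"
  shows "laplace_transform M X t \<le> 1"
  unfolding laplace_transform_def
  by (rule integral_le_const[OF integrable_exp_neg_mult])
     (use assms in \<open>auto elim!: eventually_mono\<close>)

lemma set_integrable_lborel_powr:
  fixes a c :: real
  shows "a > -1 \<Longrightarrow> c \<ge> 0 \<Longrightarrow> set_integrable lborel {0<..c} (\<lambda>t. t powr a)"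
    and "a < -1 \<Longrightarrow> c > 0 \<Longrightarrow> set_integrable lborel {c..} (\<lambda>t. t powr a)"
proof -
  have *: "set_integrable lborel S (\<lambda>t. t powr a)"
    if "(\<lambda>t. t powr a) integrable_on S" "S \<in> sets borel" for S
  proof -
    have "integrable (completion lborel) (\<lambda>t. indicator S t *\<^sub>R t powr a)"
      using nonnegative_absolutely_integrable_1[OF that(1)] by (simp add: set_integrable_def)
    then show ?thesis
      unfolding set_integrable_def by (subst (asm) integrable_completion) (use that in measurable)
  qed
  show "a > -1 \<Longrightarrow> c \<ge> 0 \<Longrightarrow> set_integrable lborel {0<..c} (\<lambda>t. t powr a)"
    by (rule *[OF integrable_on_powr_from_0']) auto
  show "a < -1 \<Longrightarrow> c > 0 \<Longrightarrow> set_integrable lborel {c..} (\<lambda>t. t powr a)"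
    by (rule *[OF has_integral_integrable[OF has_integral_powr_to_inf]]) auto
qed

text \<open>
  Near \<open>0\<close> the bound \<open>\<psi> \<le> 1\<close> suffices because \<open>s - 1 > -1\<close>; near infinity the integrand is
  \<open>O(t\<^sup>s\<^sup>-\<^sup>1\<^sup>-\<^sup>N)\<close> with exponent below \<open>-1\<close>.
\<close>
lemma (in prob_space) set_integrable_mellin_laplace_of_bigo:
  assumes X [measurable]: "X \<in> borel_measurable M" and pos: "AE \<omega> in M. X \<omega> > 0"
    and s: "s > 0" "real N > s"
    and bigo: "laplace_transform M X \<in> O[at_top](\<lambda>t. t powr (- real N))"
  shows "set_integrable lborel {0<..} (\<lambda>t. t powr (s - 1) * laplace_transform M X t)" (is "set_integrable _ _ ?f")
proof -
  have [measurable]: "laplace_transform M X \<in> borel_measurable borel"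
    unfolding laplace_transform_def by measurable
  have nonneg: "laplace_transform M X t \<ge> 0" for t
    by (simp add: laplace_transform_def)
  from bigo obtain C where "eventually (\<lambda>t. norm (laplace_transform M X t) \<le> C * norm (t powr (- real N))) at_top"
    by (rule landau_o.bigE)
  then obtain T where T: "norm (laplace_transform M X t) \<le> C * norm (t powr (- real N))" if "t \<ge> T" for t
    by (auto simp: eventually_at_top_linorder)
  \<comment> \<open>The split point must be positive for the power to be integrable on the right of it.\<close>
  define c where "c = max T 1"
  have c: "c > 0" "c \<ge> T"
    by (auto simp: c_def)
  have "set_integrable lborel {0<..c} ?f"
  proof (rule set_integrable_bound)
    show "set_integrable lborel {0<..c} (\<lambda>t. t powr (s - 1))"
      using s c by (intro set_integrable_lborel_powr) auto
    show "AE t in lborel. t \<in> {0<..c} \<longrightarrow> norm (?f t) \<le> norm (t powr (s - 1))"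
      using nonneg laplace_transform_le_1[OF X pos] by (auto simp: abs_mult intro!: mult_left_le)
  qed (simp add: set_borel_measurable_def)
  moreover have "set_integrable lborel {c..} ?f"
  proof (rule set_integrable_bound)
    show "set_integrable lborel {c..} (\<lambda>t. C * t powr (s - 1 - real N))"
      using s c by (intro set_integrable_mult_right set_integrable_lborel_powr) auto
    show "AE t in lborel. t \<in> {c..} \<longrightarrow> norm (?f t) \<le> norm (C * t powr (s - 1 - real N))"
    proof (intro AE_I2 impI)
      fix t assume "t \<in> {c..}"
      then have t: "t > 0" "t \<ge> T"
        using c by auto
      have "norm (?f t) \<le> t powr (s - 1) * (C * t powr (- real N))"
        using T[OF t(2)] by (auto simp: abs_mult intro!: mult_left_mono)
      also have "\<dots> = C * t powr (s - 1 - real N)"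
        by (simp add: powr_add [symmetric] mult_ac)
      finally show "norm (?f t) \<le> norm (C * t powr (s - 1 - real N))"
        by simp
    qed
  qed (simp add: set_borel_measurable_def)
  ultimately have "set_integrable lborel ({0<..c} \<union> {c..}) ?f"
    by (rule set_integrable_Un) auto
  also have "{0<..c} \<union> {c..} = {0<..}"
    using c by auto
  finally show ?thesis .
qed

section \<open>Analyticity of the moments\<close>

text \<open>
  Expand the exponential. The partial sums of \<open>e\<^sup>z\<^sup>L\<close> are all dominated by \<open>e\<close> to the power
  \<open>|z| |L|\<close>, which is integrable, so they may be integrated term by term. The result is a power
  series in \<open>z\<close> with coefficients \<open>E L\<^sup>n / n!\<close> that converges in the whole plane.
\<close>
lemma
  fixes L :: "'a \<Rightarrow> real"
  assumes [measurable]: "L \<in> borel_measurable M"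
    and int: "\<And>r. integrable M (\<lambda>\<omega>. exp (r * \<bar>L \<omega>\<bar>))"
  shows integrable_exp_of_exp_abs: "integrable M (\<lambda>\<omega>. exp (z * complex_of_real (L \<omega>)))"
    and holomorphic_integral_exp:
      "(\<lambda>z. \<integral>\<omega>. exp (z * complex_of_real (L \<omega>)) \<partial>M) holomorphic_on UNIV"
proof -
  define u where "u z n \<omega> = (z * complex_of_real (L \<omega>)) ^ n /\<^sub>R fact n" for z n \<omega>
  define w where "w z \<omega> = exp (norm z * \<bar>L \<omega>\<bar>)" for z :: complex and \<omega>
  have [measurable]: "u z n \<in> borel_measurable M" for z n
    unfolding u_def by measurable
  have w: "integrable M (w z)" for z
    unfolding w_def by (rule int)
  have norm_u: "norm (u z n \<omega>) = (norm z * \<bar>L \<omega>\<bar>) ^ n /\<^sub>R fact n" for z n \<omega>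
    by (simp add: u_def norm_mult norm_power)
  have sum_norm_u: "(\<Sum>n\<in>A. norm (u z n \<omega>)) \<le> w z \<omega>" if "finite A" for z \<omega> A
    unfolding norm_u w_def exp_def
    by (rule sum_le_suminf[OF summable_exp_generic that]) auto
  have u: "integrable M (u z n)" for z n
    by (rule Bochner_Integration.integrable_bound[OF w[of z]])
       (use sum_norm_u[of "{n}" z] in \<open>auto simp: w_def\<close>)
  have bound: "norm (\<Sum>n<N. u z n \<omega>) \<le> w z \<omega>" for z N \<omega>
    using norm_sum sum_norm_u[of "{..<N}" z] by (rule order_trans) auto
  have lim: "(\<lambda>N. \<Sum>n<N. u z n \<omega>) \<longlonglongrightarrow> exp (z * complex_of_real (L \<omega>))" for z \<omega>
    using exp_converges[of "z * complex_of_real (L \<omega>)"] by (simp add: sums_def u_def)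
  show "integrable M (\<lambda>\<omega>. exp (z * complex_of_real (L \<omega>)))"
    by (rule integrable_dominated_convergence[where w = "w z" and s = "\<lambda>N \<omega>. \<Sum>n<N. u z n \<omega>"])
       (use w bound lim in auto)
  define a where "a n = (\<integral>\<omega>. complex_of_real (L \<omega>) ^ n /\<^sub>R fact n \<partial>M)" for n
  have a: "(\<integral>\<omega>. u z n \<omega> \<partial>M) = a n * z ^ n" for z n
    by (simp add: u_def a_def power_mult_distrib mult_ac flip: integral_mult_right_zero)
  have sums: "(\<lambda>n. a n * (z - 0) ^ n) sums (\<integral>\<omega>. exp (z * complex_of_real (L \<omega>)) \<partial>M)" for z
  proof -
    have "(\<lambda>N. \<integral>\<omega>. (\<Sum>n<N. u z n \<omega>) \<partial>M) \<longlonglongrightarrow> (\<integral>\<omega>. exp (z * complex_of_real (L \<omega>)) \<partial>M)"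
      by (rule integral_dominated_convergence[where w = "w z"]) (use w bound lim in auto)
    then show ?thesis
      using u a by (simp add: sums_def)
  qed
  have "(\<lambda>z. \<integral>\<omega>. exp (z * complex_of_real (L \<omega>)) \<partial>M) holomorphic_on (\<Union>r. ball 0 r)"
    by (rule holomorphic_on_UN_open) (use power_series_holomorphic[OF sums] in auto)
  moreover have "(\<Union>r. ball 0 r) = (UNIV :: complex set)"
    using gt_ex by auto
  ultimately show "(\<lambda>z. \<integral>\<omega>. exp (z * complex_of_real (L \<omega>)) \<partial>M) holomorphic_on UNIV"
    by simp
qed

lemma borel_measurable_of_real_powr:
  assumes [measurable]: "X \<in> borel_measurable M"
  shows "(\<lambda>\<omega>. complex_of_real (X \<omega>) powr s) \<in> borel_measurable M"
  unfolding powr_def by measurable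

text \<open>
  Writing \<open>X\<^sup>-\<^sup>s = e\<^sup>s\<^sup>L\<close> with \<open>L = - ln X\<close> reduces the claim to exponential moments of \<open>|L|\<close>. They
  are finite because one of the two terms of \<open>X\<^sup>r + X\<^sup>-\<^sup>r\<close> equals \<open>e\<^sup>r\<^sup>|\<^sup>L\<^sup>|\<close>.
\<close>
lemma
  assumes X [measurable]: "X \<in> borel_measurable M" and pos: "AE \<omega> in M. X \<omega> > 0"
    and int: "\<And>r::real. integrable M (\<lambda>\<omega>. X \<omega> powr r)"
  shows integrable_complex_powr: "integrable M (\<lambda>\<omega>. complex_of_real (X \<omega>) powr (- s))"
    and holomorphic_neg_moment: "neg_moment M X holomorphic_on UNIV"
proof -
  define L where "L \<omega> = - ln (X \<omega>)" for \<omega>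
  have [measurable]: "L \<in> borel_measurable M"
    unfolding L_def by measurable
  note [measurable] = borel_measurable_of_real_powr[OF X]
  have exp_abs: "integrable M (\<lambda>\<omega>. exp (r * \<bar>L \<omega>\<bar>))" for r
  proof (rule Bochner_Integration.integrable_bound)
    show "integrable M (\<lambda>\<omega>. X \<omega> powr r + X \<omega> powr (- r))"
      by (intro Bochner_Integration.integrable_add int)
    show "AE \<omega> in M. norm (exp (r * \<bar>L \<omega>\<bar>)) \<le> norm (X \<omega> powr r + X \<omega> powr (- r))"
      using pos
    proof eventually_elim
      case (elim \<omega>)
      then have "exp (r * \<bar>L \<omega>\<bar>) \<le> X \<omega> powr r + X \<omega> powr (- r)"
        by (cases "ln (X \<omega>) \<ge> 0") (auto simp: L_def powr_def)
      then show ?case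
        by simp
    qed
  qed simp
  have eq: "AE \<omega> in M. complex_of_real (X \<omega>) powr (- s) = exp (s * complex_of_real (L \<omega>))" for s
    using pos by eventually_elim (simp add: L_def powr_def Ln_of_real)
  show "integrable M (\<lambda>\<omega>. complex_of_real (X \<omega>) powr (- s))"
    using integrable_exp_of_exp_abs[OF _ exp_abs]
    by (subst integrable_cong_AE[OF _ _ eq]) auto
  have "neg_moment M X = (\<lambda>s. \<integral>\<omega>. exp (s * complex_of_real (L \<omega>)) \<partial>M)"
    unfolding neg_moment_def by (intro ext integral_cong_AE eq) auto
  then show "neg_moment M X holomorphic_on UNIV"
    using holomorphic_integral_exp[OF _ exp_abs] by simp
qed

text \<open>
  At a real argument the moment is the expectation of an almost surely positive variable. At the
  nonpositive integers this prevents the entire factor from cancelling a pole of \<open>\<Gamma>\<close>.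
\<close>
lemma (in prob_space) neg_moment_of_real_neq_0:
  assumes X [measurable]: "X \<in> borel_measurable M" and pos: "AE \<omega> in M. X \<omega> > 0"
    and int: "integrable M (\<lambda>\<omega>. X \<omega> powr (- r))"
  shows "neg_moment M X (of_real r) \<noteq> 0"
proof
  assume "neg_moment M X (of_real r) = 0"
  moreover have "neg_moment M X (of_real r) = (\<integral>\<omega>. complex_of_real (X \<omega> powr (- r)) \<partial>M)"
    unfolding neg_moment_def
  proof (rule integral_cong_AE)
    show "AE \<omega> in M. complex_of_real (X \<omega>) powr (- of_real r) = complex_of_real (X \<omega> powr (- r))"
      using pos by eventually_elim (simp flip: powr_of_real)
  qed (use borel_measurable_of_real_powr[OF X] in auto)
  ultimately have "(\<integral>\<omega>. X \<omega> powr (- r) \<partial>M) = 0"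
    by simp
  then have "AE \<omega> in M. X \<omega> powr (- r) = 0"
    using int by (simp add: integral_nonneg_eq_0_iff_AE)
  with pos have "AE \<omega> in M. False"
    by eventually_elim simp
  then show False
    by simp
qed

text \<open>
  Meromorphy follows from \<open>\<Gamma> = 1 / rGamma\<close> with \<open>rGamma\<close> entire. A nicely meromorphic function has
  to take the value \<open>0\<close> at its poles and to be continuous elsewhere. The product is \<open>0\<close> at every
  nonpositive integer, since \<open>\<Gamma>\<close> is defined to be \<open>0\<close> there, so each of these points must be a
  genuine pole of the product; the nonvanishing of \<open>f\<close> ensures this.
\<close>
lemma Gamma_times_entire_nicely_meromorphic:
  assumes f: "f holomorphic_on UNIV" and nz: "\<And>n. f (- of_nat n) \<noteq> 0"
  shows "(\<lambda>s. Gamma s * f s) nicely_meromorphic_on UNIV"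
  unfolding nicely_meromorphic_on_def
proof (intro conjI ballI)
  have f': "f analytic_on A" for A
    using f analytic_on_open[of UNIV f] analytic_on_subset by auto
  have "(\<lambda>s. inverse (rGamma s) * f s) meromorphic_on UNIV"
    by (intro meromorphic_intros analytic_on_imp_meromorphic_on analytic_rGamma f')
  then show "(\<lambda>s. Gamma s * f s) meromorphic_on UNIV"
    by (simp add: Gamma_def)
  fix z :: complex
  have lim: "f \<midarrow>z\<rightarrow> f z"
    using analytic_at_imp_isCont[OF f'] by (rule isContD)
  show "is_pole (\<lambda>s. Gamma s * f s) z \<and> Gamma z * f z = 0 \<or>
        (\<lambda>s. Gamma s * f s) \<midarrow>z\<rightarrow> Gamma z * f z"
  proof (cases "z \<in> \<int>\<^sub>\<le>\<^sub>0")
    case True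
    then obtain n where n: "z = - of_nat n"
      by (elim nonpos_Ints_cases')
    have "filterlim Gamma at_infinity (at z)" "f z \<noteq> 0"
      unfolding n by (rule Gamma_poles nz)+
    then have "filterlim (\<lambda>s. f s * Gamma s) at_infinity (at z)"
      using tendsto_mult_filterlim_at_infinity[OF lim] by blast
    moreover have "Gamma z = 0"
      using True by (simp add: Gamma_eq_zero_iff)
    ultimately show ?thesis
      by (simp add: is_pole_def mult.commute)
  next
    case False
    then have "Gamma analytic_on {z}"
      by (intro analytic_Gamma) auto
    then show ?thesis
      using tendsto_mult[OF isContD[OF analytic_at_imp_isCont] lim] by blast
  qed
qed

theorem lemmaB1:
  fixes M :: "'a measure" and X :: "'a \<Rightarrow> real"
  assumes "prob_space M"
    and "X \<in> borel_measurable M"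
    and "AE \<omega> in M. X \<omega> > 0"
  shows "(negative_moments_finite M X \<longleftrightarrow>
            (\<forall>s::real. s > 0 \<longrightarrow>
              set_integrable lborel {0<..} (\<lambda>t. t powr (s - 1) * laplace_transform M X t)))
       \<and> (negative_moments_finite M X \<longleftrightarrow>
            (\<forall>N::nat. laplace_transform M X \<in> O[at_top](\<lambda>t. t powr (- real N))))
       \<and> (negative_moments_finite M X \<and> positive_moments_finite M X \<longrightarrow>
            (\<forall>s::complex. integrable M (\<lambda>\<omega>. complex_of_real (X \<omega>) powr (- s)))
          \<and> neg_moment M X holomorphic_on UNIV
          \<and> (\<forall>s::complex. Re s > 0 \<longrightarrow>
               set_integrable lborel {0<..}
                 (\<lambda>t. complex_of_real t powr (s - 1) * complex_of_real (laplace_transform M X t))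
             \<and> (LINT t:{0<..}|lborel.
                  complex_of_real t powr (s - 1) * complex_of_real (laplace_transform M X t))
                = Gamma s * neg_moment M X s)
          \<and> (\<lambda>s. Gamma s * neg_moment M X s) nicely_meromorphic_on UNIV)"
proof -
  interpret prob_space M by fact
  note X = \<open>X \<in> borel_measurable M\<close> and pos = \<open>AE \<omega> in M. X \<omega> > 0\<close>
  let ?mellin = "\<lambda>s. set_integrable lborel {0<..} (\<lambda>t. t powr (s - 1) * laplace_transform M X t)"
  let ?decay = "\<lambda>N::nat. laplace_transform M X \<in> O[at_top](\<lambda>t. t powr (- real N))"

  have mellin_iff: "integrable M (\<lambda>\<omega>. X \<omega> powr (- s)) \<longleftrightarrow> ?mellin s" if "s > 0" for s
    using integrable_mellin_kernel_iff_neg_moment[OF X pos, of "of_real s"]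
      integrable_mellin_kernel_iff_laplace[OF X pos, of "of_real s"] that by simp
  then have i_ii: "negative_moments_finite M X \<longleftrightarrow> (\<forall>s>0. ?mellin s)"
    by (auto simp: negative_moments_finite_def)

  \<comment> \<open>Finiteness of the moments is a condition on nonzero exponents; the exponent \<open>0\<close> arises for
    \<open>N = 0\<close> and for the moment at the origin.\<close>
  have powr_0: "integrable M (\<lambda>\<omega>. X \<omega> powr 0)"
    by (rule integrable_const_bound[where B = 1]) (use X in auto)
  have "?decay N" if "negative_moments_finite M X" for N
  proof (rule laplace_transform_bigo_powr[OF X pos])
    show "integrable M (\<lambda>\<omega>. X \<omega> powr (- real N))"
      using that powr_0 by (cases "N = 0") (auto simp: negative_moments_finite_def)
  qed
  moreover have "?mellin s" if "\<forall>N. ?decay N" "s > 0" for s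
  proof -
    obtain N :: nat where "real N > s"
      using reals_Archimedean2 by blast
    then show ?thesis
      using that by (intro set_integrable_mellin_laplace_of_bigo[OF X pos]) auto
  qed
  ultimately have i_iii: "negative_moments_finite M X \<longleftrightarrow> (\<forall>N. ?decay N)"
    using i_ii by blast

  show ?thesis
  proof (intro conjI impI allI i_ii i_iii; (elim conjE)?)
    assume "negative_moments_finite M X" "positive_moments_finite M X"
    then have all: "integrable M (\<lambda>\<omega>. X \<omega> powr r)" for r
      using powr_0 unfolding negative_moments_finite_def positive_moments_finite_def
      by (metis linorder_cases minus_minus neg_0_less_iff_less)
    show "integrable M (\<lambda>\<omega>. complex_of_real (X \<omega>) powr (- s))" for s
      by (rule integrable_complex_powr[OF X pos all])
    show holo: "neg_moment M X holomorphic_on UNIV"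
      by (rule holomorphic_neg_moment[OF X pos all])
    show "set_integrable lborel {0<..}
            (\<lambda>t. complex_of_real t powr (s - 1) * complex_of_real (laplace_transform M X t))"
      and "(LINT t:{0<..}|lborel.
              complex_of_real t powr (s - 1) * complex_of_real (laplace_transform M X t))
            = Gamma s * neg_moment M X s" if "Re s > 0" for s
      by (rule mellin_transform_laplace_transform[OF X pos that all])+
    show "(\<lambda>s. Gamma s * neg_moment M X s) nicely_meromorphic_on UNIV"
    proof (rule Gamma_times_entire_nicely_meromorphic[OF holo])
      show "neg_moment M X (- of_nat n) \<noteq> 0" for n
        using neg_moment_of_real_neq_0[OF X pos all, of "- real n"] by simp
    qed
  qed
qed

end
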